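(* For every triple $(A(q),B(q),C(q))$ on the deformed squared Markov tree, $A(q)$, $B(q)$ and $C(q)$ are Laurent polynomials in $q$ with positive integer coefficients that are symmetric under $q\leftrightarrow q^{-1}$.
   Context: Let $q$ be an indeterminate. The deformed squared Markov equation is $$X^2+Y^2+Z^2+(q+q^{-1})(XY+YZ+XZ)=3(1+q+q^{-1})XYZ.$$ Given a solution $(A,B,C)$ with non-zero entries, the mutation at $A$ replaces $A$ by $$A'=\frac{B^2+(q+q^{-1})BC+C^2}{A}=3(1+q+q^{-1})BC-(q+q^{-1})(B+C)-A,$$ leaving $B,C$ unchanged; mutations at $B$ and at $C$ are defined in the same way by exchanging the roles of the coordinates. The deformed squared Markov tree is the graph whose vertices are all triples obtained from the solution $(1,1,1)$ by finite sequences of mutations (at any coordinates), with edges given by mutations. A Laurent polynomial $A(q)$ is symmetric if $A(q)=A(q^{-1})$. "With positive integer coefficients" means non-zero, with all non-zero coefficients being positive integers. *)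

theory Defs
  imports
    "HOL-Computational_Algebra.Polynomial"
    "HOL-Computational_Algebra.Fraction_Field"
    "HOL-Library.Poly_Mapping"
begin

text \<open>
  All computations take place in the field \<open>\<rat>(q)\<close> of rational functions in the
  indeterminate \<open>q\<close>, realised as the fraction field of \<open>\<rat>[q]\<close>.
\<close>

type_synonym ratfun = "rat poly fract"

definition q :: ratfun where
  "q = Fract [:0, 1:] 1"

type_synonym triple = "ratfun \<times> ratfun \<times> ratfun"

definition deformed_squared_markov_solution :: "triple \<Rightarrow> bool" where
  "deformed_squared_markov_solution = (\<lambda>(X, Y, Z).
     X^2 + Y^2 + Z^2 + (q + inverse q) * (X*Y + Y*Z + X*Z)
       = 3 * (1 + q + inverse q) * X * Y * Z)"

text \<open>
  Division in \<open>\<rat>(q)\<close> is total, with \<open>x / 0 = 0\<close>.  This is harmless below: a zero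
  entry at any vertex of the tree would contradict the positivity asserted by the theorem.
\<close>

definition mutated_entry :: "ratfun \<Rightarrow> ratfun \<Rightarrow> ratfun \<Rightarrow> ratfun" where
  "mutated_entry A B C = (B^2 + (q + inverse q) * B * C + C^2) / A"

inductive mutation :: "triple \<Rightarrow> triple \<Rightarrow> bool" where
  fst: "mutation (A, B, C) (mutated_entry A B C, B, C)"
| snd: "mutation (A, B, C) (A, mutated_entry B A C, C)"
| trd: "mutation (A, B, C) (A, B, mutated_entry C A B)"

text \<open>The vertex set of the tree; its edges are given by \<^const>\<open>mutation\<close>.\<close>

definition deformed_squared_markov_tree :: "triple set" where
  "deformed_squared_markov_tree = {t. mutation\<^sup>*\<^sup>* (1, 1, 1) t}"

text \<open>
  A Laurent polynomial \<open>\<Sum>\<^sub>n c\<^sub>n q\<^sup>n\<close> with integer coefficients is given by its finitely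
  supported family of coefficients, indexed by the integers.
\<close>

definition laurent_eval :: "(int \<Rightarrow>\<^sub>0 int) \<Rightarrow> ratfun \<Rightarrow> ratfun" where
  "laurent_eval p x = (\<Sum>n\<in>Poly_Mapping.keys p. of_int (Poly_Mapping.lookup p n) * x powi n)"

definition positive_coefficients :: "(int \<Rightarrow>\<^sub>0 int) \<Rightarrow> bool" where
  "positive_coefficients p \<longleftrightarrow>
     p \<noteq> 0 \<and> (\<forall>n\<in>Poly_Mapping.keys p. Poly_Mapping.lookup p n > 0)"

definition symmetric_laurent :: "(int \<Rightarrow>\<^sub>0 int) \<Rightarrow> bool" where
  "symmetric_laurent p \<longleftrightarrow> laurent_eval p q = laurent_eval p (inverse q)"

definition positive_symmetric_laurent :: "ratfun \<Rightarrow> bool" where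
  "positive_symmetric_laurent F \<longleftrightarrow>
     (\<exists>p. F = laurent_eval p q \<and> positive_coefficients p \<and> symmetric_laurent p)"

lemma q_nonzero: "q \<noteq> 0"
  by (simp add: q_def Zero_fract_def eq_fract)

lemma solution_one: "deformed_squared_markov_solution (1, 1, 1)"
  by (simp add: deformed_squared_markov_solution_def algebra_simps)

text \<open>The two expressions for the mutated entry agree on solutions (the roots of a quadratic).\<close>

lemma mutated_entry_eq:
  assumes "deformed_squared_markov_solution (A, B, C)" and "A \<noteq> 0"
  shows "mutated_entry A B C
           = 3 * (1 + q + inverse q) * B * C - (q + inverse q) * (B + C) - A"
proof -
  have "B^2 + (q + inverse q) * B * C + C^2
          = (3 * (1 + q + inverse q) * B * C - (q + inverse q) * (B + C) - A) * A"
    using assms(1) unfolding deformed_squared_markov_solution_def prod.case by algebra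
  then show ?thesis
    using assms(2) by (simp add: mutated_entry_def)
qed

end

theory Submission
  imports Defs
begin

text \<open>
  Put \<open>s = q + q\<^sup>-\<^sup>1\<close>.  On solutions, mutation at \<open>B\<close> produces
  \<open>B' = 3 (1 + s) A C - s (A + C) - B\<close>, and the only danger to positivity is the
  subtracted terms.  Compare Laurent polynomials coefficientwise, writing \<open>X \<preceq> Y\<close> when
  \<open>Y - X\<close> is symmetric with non-negative coefficients.  The elements \<open>\<succeq> 0\<close> form a semiring
  containing \<open>s\<close>, so \<open>1 \<preceq> A, C\<close> implies \<open>A, C \<preceq> A C\<close>.  If moreover \<open>B \<preceq> A\<close>, then each of
  the subtracted terms is dominated by one of the copies of \<open>A C\<close> or \<open>s A C\<close>, with enough left over
  that \<open>A, C \<preceq> B'\<close>.  Hence along any sequence of mutations that never undoes the preceding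
  one, the newest entry dominates the other two, and every entry dominates \<open>1\<close>
  (\<open>dominated_triple_mutate\<close>).

  Mutating the newest entry again restores the previous triple, because the two values of an
  entry have the product \<open>B\<^sup>2 + s B C + C\<^sup>2\<close>.  So the mutations that only move away from
  \<open>(1, 1, 1)\<close> already reach, up to the order of the entries, every vertex of the tree
  (\<open>generated_unordered_mutate\<close>).

  Dividing by an entry is legitimate because the field of rational functions is ordered by the
  sign of the leading coefficient; there \<open>q > 0\<close>, so everything \<open>\<succeq> 1\<close> is positive.
\<close>

section \<open>Evaluation of Laurent polynomials\<close>

lemma laurent_eval_zero: "laurent_eval 0 x = 0"
  by (simp add: laurent_eval_def)

lemma laurent_eval_add: "laurent_eval (p + r) x = laurent_eval p x + laurent_eval r x"
  unfolding laurent_eval_def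
  by (rule setsum_keys_plus_distrib[where f = "\<lambda>n c. of_int c * x powi n"])
    (simp_all add: algebra_simps)

lemma laurent_eval_single: "laurent_eval (Poly_Mapping.single n c) x = of_int c * x powi n"
  by (cases "c = 0") (simp_all add: laurent_eval_def)

lemma laurent_eval_one: "laurent_eval 1 x = 1"
  using laurent_eval_single[of 0 1 x] by simp

lemma poly_mapping_add_single_induct [case_names zero add_single]:
  fixes p :: "'a \<Rightarrow>\<^sub>0 'b::comm_monoid_add"
  assumes "P 0" "\<And>p n c. P p \<Longrightarrow> P (Poly_Mapping.single n c + p)"
  shows "P p"
proof (induction p rule: update_induct)
  case const
  show ?case by fact
next
  case (update p n c)
  then have "Poly_Mapping.update n c p = Poly_Mapping.single n c + p"
    by (intro poly_mapping_eqI)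
      (auto simp: lookup_update lookup_add lookup_single when_def in_keys_iff)
  then show ?case
    using assms(2) update.IH by simp
qed

lemma laurent_eval_mult:
  assumes "x \<noteq> 0"
  shows "laurent_eval (p * r) x = laurent_eval p x * laurent_eval r x"
proof (induction p rule: poly_mapping_add_single_induct)
  case zero
  show ?case
    by (simp add: laurent_eval_zero)
next
  case (add_single p m c)
  have "laurent_eval (Poly_Mapping.single m c * r) x
          = laurent_eval (Poly_Mapping.single m c) x * laurent_eval r x"
  proof (induction r rule: poly_mapping_add_single_induct)
    case zero
    show ?case
      by (simp add: laurent_eval_zero)
  next
    case (add_single r n d)
    have "laurent_eval (Poly_Mapping.single m c * Poly_Mapping.single n d) x
        = laurent_eval (Poly_Mapping.single m c) x * laurent_eval (Poly_Mapping.single n d) x"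
      using assms by (simp add: mult_single laurent_eval_single power_int_add)
    then show ?case
      using add_single by (simp only: distrib_left laurent_eval_add)
  qed
  then show ?case
    using add_single by (simp only: distrib_right laurent_eval_add)
qed

section \<open>The cone of non-negative symmetric Laurent polynomials\<close>

definition nonneg_symmetric :: "ratfun set" where
  "nonneg_symmetric =
     {laurent_eval p q | p. (\<forall>n. Poly_Mapping.lookup p n \<ge> 0) \<and> symmetric_laurent p}"

lemma nonneg_symmetric_zero: "0 \<in> nonneg_symmetric"
  unfolding nonneg_symmetric_def
  by (auto intro!: exI[of _ 0] simp: symmetric_laurent_def laurent_eval_zero)

lemma nonneg_symmetric_one: "1 \<in> nonneg_symmetric"
proof -
  have "symmetric_laurent 1" "1 = laurent_eval 1 q"
    by (simp_all add: symmetric_laurent_def laurent_eval_one)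
  moreover have "\<forall>n. Poly_Mapping.lookup (1 :: int \<Rightarrow>\<^sub>0 int) n \<ge> 0"
    by (simp add: lookup_one when_def)
  ultimately show ?thesis
    unfolding nonneg_symmetric_def by blast
qed

lemma nonneg_symmetric_q: "q + inverse q \<in> nonneg_symmetric"
proof -
  let ?p = "Poly_Mapping.single 1 1 + Poly_Mapping.single (- 1) 1 :: int \<Rightarrow>\<^sub>0 int"
  have ev: "laurent_eval ?p x = x + inverse x" for x
    by (simp add: laurent_eval_add laurent_eval_single power_int_minus)
  have "symmetric_laurent ?p" "q + inverse q = laurent_eval ?p q"
    unfolding symmetric_laurent_def ev by (simp_all add: add.commute)
  moreover have "\<forall>n. Poly_Mapping.lookup ?p n \<ge> 0"
    by (simp add: lookup_add lookup_single when_def)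
  ultimately show ?thesis
    unfolding nonneg_symmetric_def by blast
qed

lemma nonneg_symmetric_add:
  assumes "X \<in> nonneg_symmetric" "Y \<in> nonneg_symmetric"
  shows "X + Y \<in> nonneg_symmetric"
proof -
  from assms obtain p r where
    "X = laurent_eval p q" "\<forall>n. Poly_Mapping.lookup p n \<ge> 0" "symmetric_laurent p"
    "Y = laurent_eval r q" "\<forall>n. Poly_Mapping.lookup r n \<ge> 0" "symmetric_laurent r"
    unfolding nonneg_symmetric_def by blast
  then have "X + Y = laurent_eval (p + r) q" "symmetric_laurent (p + r)"
      "\<forall>n. Poly_Mapping.lookup (p + r) n \<ge> 0"
    by (simp_all add: laurent_eval_add symmetric_laurent_def lookup_add)
  then show ?thesis
    unfolding nonneg_symmetric_def by blast
qed

lemma lookup_mult_nonneg: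
  fixes p r :: "int \<Rightarrow>\<^sub>0 int"
  assumes "\<And>n. Poly_Mapping.lookup p n \<ge> 0" "\<And>n. Poly_Mapping.lookup r n \<ge> 0"
  shows "Poly_Mapping.lookup (p * r) n \<ge> 0"
  unfolding lookup_mult Sum_any.expand_set
  by (intro sum_nonneg mult_nonneg_nonneg assms) (simp add: assms when_def)

lemma nonneg_symmetric_mult:
  assumes "X \<in> nonneg_symmetric" "Y \<in> nonneg_symmetric"
  shows "X * Y \<in> nonneg_symmetric"
proof -
  from assms obtain p r where
    "X = laurent_eval p q" "\<forall>n. Poly_Mapping.lookup p n \<ge> 0" "symmetric_laurent p"
    "Y = laurent_eval r q" "\<forall>n. Poly_Mapping.lookup r n \<ge> 0" "symmetric_laurent r"
    unfolding nonneg_symmetric_def by blast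
  then have "X * Y = laurent_eval (p * r) q" "symmetric_laurent (p * r)"
      "\<forall>n. Poly_Mapping.lookup (p * r) n \<ge> 0"
    by (simp_all add: laurent_eval_mult symmetric_laurent_def q_nonzero lookup_mult_nonneg)
  then show ?thesis
    unfolding nonneg_symmetric_def by blast
qed

lemma q_pos: "q > 0"
  by (simp add: q_def Zero_fract_def less_fract less_poly_def pos_poly_def)

lemma nonneg_symmetric_nonneg:
  assumes "X \<in> nonneg_symmetric"
  shows "X \<ge> 0"
proof -
  obtain p where X: "X = laurent_eval p q" and p: "\<And>n. Poly_Mapping.lookup p n \<ge> 0"
    using assms unfolding nonneg_symmetric_def by blast
  show ?thesis
    unfolding X laurent_eval_def
    by (intro sum_nonneg mult_nonneg_nonneg zero_le_power_int less_imp_le[OF q_pos])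
      (simp add: p)
qed

section \<open>Coefficientwise comparison\<close>

definition dominated :: "ratfun \<Rightarrow> ratfun \<Rightarrow> bool"  (infix \<open>\<preceq>\<close> 50) where
  "X \<preceq> Y \<longleftrightarrow> Y - X \<in> nonneg_symmetric"

lemma dominated_trans: "X \<preceq> Y \<Longrightarrow> Y \<preceq> Z \<Longrightarrow> X \<preceq> Z"
  using nonneg_symmetric_add[of "Y - X" "Z - Y"] by (simp add: dominated_def)

lemma dominated_one_mem: "1 \<preceq> X \<Longrightarrow> X \<in> nonneg_symmetric"
  using nonneg_symmetric_add[OF nonneg_symmetric_one, of "X - 1"] by (simp add: dominated_def)

lemma dominated_one_nonzero: "1 \<preceq> X \<Longrightarrow> X \<noteq> 0"
  using nonneg_symmetric_nonneg[of "X - 1"] by (auto simp: dominated_def)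

lemma dominated_mult: "X \<preceq> X * Y" if "1 \<preceq> X" "1 \<preceq> Y"
  using nonneg_symmetric_mult[OF dominated_one_mem[OF that(1)], of "Y - 1"] that(2)
  by (simp add: dominated_def algebra_simps)

text \<open>
  The constant term of \<open>X\<close> is at least \<open>1\<close>, which supplies the non-vanishing that membership in
  the cone alone would not give.
\<close>

lemma dominated_one_positive_symmetric:
  assumes "1 \<preceq> X"
  shows "positive_symmetric_laurent X"
proof -
  obtain p where X: "X - 1 = laurent_eval p q"
    and p: "\<And>n. Poly_Mapping.lookup p n \<ge> 0" "symmetric_laurent p"
    using assms unfolding dominated_def nonneg_symmetric_def by blast
  have "Poly_Mapping.lookup (1 + p) 0 > 0"
    using p(1)[of 0] by (simp add: lookup_add lookup_one)
  then have "1 + p \<noteq> 0"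
    by auto
  moreover have "Poly_Mapping.lookup (1 + p) n \<ge> 0" for n
    using p(1)[of n] by (simp add: lookup_add lookup_one when_def)
  ultimately have "positive_coefficients (1 + p)"
    by (auto simp: positive_coefficients_def in_keys_iff order.strict_iff_order)
  moreover have "symmetric_laurent (1 + p)"
    using p(2) by (simp add: symmetric_laurent_def laurent_eval_add laurent_eval_one)
  moreover have "X = laurent_eval (1 + p) q"
    using X by (simp add: laurent_eval_add laurent_eval_one algebra_simps)
  ultimately show ?thesis
    unfolding positive_symmetric_laurent_def by blast
qed

section \<open>Mutations away from the root\<close>

lemma mutated_entry_commute: "mutated_entry A B C = mutated_entry A C B"
  by (simp add: mutated_entry_def algebra_simps)

lemma solution_swap:
  "deformed_squared_markov_solution (A, B, C) \<Longrightarrow> deformed_squared_markov_solution (B, A, C)"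
  "deformed_squared_markov_solution (A, B, C) \<Longrightarrow> deformed_squared_markov_solution (A, C, B)"
  by (simp_all add: deformed_squared_markov_solution_def algebra_simps)

text \<open>
  For fixed \<open>B\<close> and \<open>C\<close> the equation is quadratic in the first entry, and mutation exchanges its
  two roots.
\<close>

lemma solution_mutated_entry:
  assumes "deformed_squared_markov_solution (A, B, C)" "A \<noteq> 0"
  shows "deformed_squared_markov_solution (mutated_entry A B C, B, C)"
  using assms(1)
  unfolding mutated_entry_eq[OF assms] deformed_squared_markov_solution_def prod.case
  by algebra

lemma mutated_entry_involution:
  assumes "A \<noteq> 0" "mutated_entry A B C \<noteq> 0"
  shows "mutated_entry (mutated_entry A B C) B C = A"
  using assms by (simp add: mutated_entry_def)

text \<open>
  The first entry is the one created last.  The next mutation subtracts one of the other two, so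
  it is these that need an upper bound.
\<close>

definition dominated_triple :: "ratfun \<Rightarrow> ratfun \<Rightarrow> ratfun \<Rightarrow> bool" where
  "dominated_triple A B C \<longleftrightarrow> deformed_squared_markov_solution (A, B, C) \<and>
     1 \<preceq> B \<and> 1 \<preceq> C \<and> B \<preceq> A \<and> C \<preceq> A"

lemma dominated_triple_one:
  assumes "dominated_triple A B C"
  shows "1 \<preceq> A" "1 \<preceq> B" "1 \<preceq> C"
  using assms dominated_trans[of 1 B A] by (simp_all add: dominated_triple_def)

text \<open>
  With \<open>s = q + q\<^sup>-\<^sup>1\<close>, two of the three copies of \<open>A C\<close> absorb \<open>B\<close> and the entry to be
  compared with \<open>B'\<close>, while two of the three copies of \<open>s A C\<close> absorb \<open>s A\<close> and \<open>s C\<close>.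
\<close>

lemma dominated_triple_mutate:
  assumes "dominated_triple A B C"
  shows "dominated_triple (mutated_entry B A C) A C"
proof -
  define s where "s = q + inverse q"
  have sol: "deformed_squared_markov_solution (B, A, C)" and BA: "B \<preceq> A"
    using assms solution_swap(1) by (simp_all add: dominated_triple_def)
  note one = dominated_triple_one[OF assms]
  have B0: "B \<noteq> 0"
    using one(2) by (rule dominated_one_nonzero)
  have mut: "mutated_entry B A C = 3 * (1 + s) * A * C - s * (A + C) - B"
    unfolding mutated_entry_eq[OF sol B0] s_def by (simp add: algebra_simps)
  have AC: "A * C \<in> nonneg_symmetric"
    using one by (intro nonneg_symmetric_mult dominated_one_mem)
  have A: "A \<preceq> A * C" and C: "C \<preceq> A * C"
    using one dominated_mult[of A C] dominated_mult[of C A] by (simp_all add: mult.commute)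
  have B: "B \<preceq> A * C"
    using BA A by (rule dominated_trans)
  have s: "s * (A * C + (A * C - A) + (A * C - C)) \<in> nonneg_symmetric"
    using AC A C nonneg_symmetric_q unfolding s_def dominated_def
    by (meson nonneg_symmetric_mult nonneg_symmetric_add)
  have le: "X \<preceq> mutated_entry B A C" if "X \<preceq> A * C" for X
  proof -
    have "mutated_entry B A C - X = A * C + (A * C - B) + (A * C - X)
            + s * (A * C + (A * C - A) + (A * C - C))"
      by (simp add: mut algebra_simps)
    also have "\<dots> \<in> nonneg_symmetric"
      using AC B that s unfolding dominated_def by (intro nonneg_symmetric_add)
    finally show ?thesis
      by (simp add: dominated_def)
  qed
  show ?thesis
    unfolding dominated_triple_def
    using solution_mutated_entry[OF sol B0] one(1,3) le[OF A] le[OF C] by blast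
qed

text \<open>
  The triples reached by moving away from the root, with the newest entry first.  Since the order
  of the two older entries is immaterial, \<open>swap\<close> lets \<open>step\<close> treat mutation of either of them.
\<close>

inductive generated :: "ratfun \<Rightarrow> ratfun \<Rightarrow> ratfun \<Rightarrow> bool" where
  root: "generated 1 1 1"
| step: "generated A B C \<Longrightarrow> generated (mutated_entry B A C) A C"
| swap: "generated A B C \<Longrightarrow> generated A C B"

lemma generated_dominated_triple: "generated A B C \<Longrightarrow> dominated_triple A B C"
proof (induction rule: generated.induct)
  case root
  have "1 \<preceq> (1 :: ratfun)"
    by (simp add: dominated_def nonneg_symmetric_zero)
  then show ?case
    by (simp add: dominated_triple_def solution_one)
next
  case (step A B C)
  then show ?case
    by (simp add: dominated_triple_mutate)
next
  case (swap A B C)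
  then show ?case
    using solution_swap(2) by (simp add: dominated_triple_def)
qed

section \<open>Every vertex of the tree\<close>

definition generated_unordered :: "ratfun \<Rightarrow> ratfun \<Rightarrow> ratfun \<Rightarrow> bool" where
  "generated_unordered X Y Z \<longleftrightarrow> generated X Y Z \<or> generated Y X Z \<or> generated Z X Y"

lemma generated_unordered_swap:
  "generated_unordered X Y Z \<Longrightarrow> generated_unordered Y X Z"
  "generated_unordered X Y Z \<Longrightarrow> generated_unordered X Z Y"
  using generated.swap by (auto simp: generated_unordered_def)

text \<open>
  Undoing the last mutation leads back to the parent.  At the root there is nothing to undo, but
  its entries are equal, so mutating the first one is as good as mutating another.
\<close>

lemma generated_mutate_newest:
  "generated A B C \<Longrightarrow> generated_unordered (mutated_entry A B C) B C"
proof (induction rule: generated.induct)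
  case root
  show ?case
    using generated.step[OF generated.root] by (simp add: generated_unordered_def)
next
  case (step A B C)
  have "1 \<preceq> B" "1 \<preceq> mutated_entry B A C"
    using generated_dominated_triple[OF step.hyps]
      generated_dominated_triple[OF generated.step[OF step.hyps]]
    by (simp_all add: dominated_triple_one)
  then have "mutated_entry (mutated_entry B A C) A C = B"
    by (intro mutated_entry_involution dominated_one_nonzero)
  then show ?case
    using step.hyps by (simp add: generated_unordered_def)
next
  case (swap A B C)
  then show ?case
    by (simp add: mutated_entry_commute[of A C B] generated_unordered_swap(2))
qed

lemma generated_unordered_mutate:
  assumes "generated_unordered X Y Z"
  shows "generated_unordered (mutated_entry X Y Z) Y Z"
  using assms unfolding generated_unordered_def[of X Y Z]
proof (elim disjE)
  assume "generated X Y Z"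
  then show ?thesis
    by (rule generated_mutate_newest)
next
  assume "generated Y X Z"
  then show ?thesis
    using generated.step by (simp add: generated_unordered_def)
next
  assume "generated Z X Y"
  then have "generated (mutated_entry X Y Z) Z Y"
    using generated.step[of Z X Y] by (simp add: mutated_entry_commute)
  then show ?thesis
    using generated.swap by (simp add: generated_unordered_def)
qed

lemma mutation_generated_unordered:
  assumes "mutation (X, Y, Z) (X', Y', Z')" "generated_unordered X Y Z"
  shows "generated_unordered X' Y' Z'"
  using assms(1)
proof cases
  case fst
  then show ?thesis
    using generated_unordered_mutate[OF assms(2)] by simp
next
  case snd
  then show ?thesis
    using generated_unordered_mutate[of Y X Z] assms(2) generated_unordered_swap(1) by simp
next
  case trd
  have "generated_unordered Z X Y"
    using assms(2) generated_unordered_swap by blast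
  then have "generated_unordered (mutated_entry Z X Y) X Y"
    by (rule generated_unordered_mutate)
  then show ?thesis
    using trd generated_unordered_swap by blast
qed

lemma tree_generated_unordered:
  assumes "(A, B, C) \<in> deformed_squared_markov_tree"
  shows "generated_unordered A B C"
proof -
  have "mutation\<^sup>*\<^sup>* (1, 1, 1) (A, B, C)"
    using assms by (simp add: deformed_squared_markov_tree_def)
  then have "case (A, B, C) of (X, Y, Z) \<Rightarrow> generated_unordered X Y Z"
  proof (induction rule: rtranclp_induct)
    case base
    show ?case
      by (simp add: generated_unordered_def generated.root)
  next
    case (step t t')
    then show ?case
      using mutation_generated_unordered by (cases t; cases t') auto
  qed
  then show ?thesis
    by simp
qed

theorem theorem2p2:
  fixes A B C :: ratfun
  assumes "(A, B, C) \<in> deformed_squared_markov_tree"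
  shows "positive_symmetric_laurent A \<and> positive_symmetric_laurent B \<and>
         positive_symmetric_laurent C"
proof -
  have "1 \<preceq> A \<and> 1 \<preceq> B \<and> 1 \<preceq> C"
    using tree_generated_unordered[OF assms] generated_dominated_triple dominated_triple_one
    unfolding generated_unordered_def by blast
  then show ?thesis
    by (simp add: dominated_one_positive_symmetric)
qed

end
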